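(* Let $Q,R,S\in\mathfrak{P}$ with $Q\cap R=\emptyset$ and $Q\cap S=\emptyset$. If $Q\oplus R\sqsubseteq_G Q\oplus S$, then $R\sqsubseteq_G S$.
   Context: $\mathfrak{P}$ is the class of finite nonempty posets and $\mathfrak{P}_r$ a fixed system of representatives of its isomorphism classes. $\mathcal{H}(P,Q)$ is the set of order-preserving maps $P\to Q$. For disjoint posets $A,B$, the ordinal sum $A\oplus B$ is the disjoint union in which additionally every element of $A$ lies below every element of $B$. For $A\subseteq P$, $x\in A$: $\gamma_A(x)$ is the set of $y\in A$ joined to $x$ by a sequence $x=z_0,\dots,z_L=y$ in $A$ ($L\ge0$) with consecutive elements strictly comparable. For a map $\xi$ on $P$, $G_\xi(x):=\gamma_{\xi^{-1}(\xi(x))}(x)$. For $R,S\in\mathfrak{P}$, a Hom-scheme from $R$ to $S$ is a family $\rho=(\rho_P)_{P\in\mathfrak{P}_r}$ of maps $\rho_P:\mathcal{H}(P,R)\to\mathcal{H}(P,S)$; it is strong if every $\rho_P$ is injective, and a G-scheme if $G_{\rho_P(\xi)}(x)=G_\xi(x)$ for all $P\in\mathfrak{P}_r$, $\xi\in\mathcal{H}(P,R)$, $x\in P$. $R\sqsubseteq_G S$ means that a strong G-scheme from $R$ to $S$ exists. *)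

theory Defs
  imports Main "HOL-Library.FuncSet"
begin

text \<open>A poset is encoded by its reflexive order relation \<open>P\<close>; its underlying set is \<open>Field P\<close>.
  The relation is empty exactly if the underlying set is.\<close>

definition fin_poset :: "'a rel \<Rightarrow> bool" where
  "fin_poset P \<longleftrightarrow> Partial_order P \<and> finite (Field P) \<and> Field P \<noteq> {}"

definition poset_iso :: "'a rel \<Rightarrow> 'b rel \<Rightarrow> bool" where
  "poset_iso P Q \<longleftrightarrow>
    (\<exists>f. bij_betw f (Field P) (Field Q) \<and>
         (\<forall>x\<in>Field P. \<forall>y\<in>Field P. (x, y) \<in> P \<longleftrightarrow> (f x, f y) \<in> Q))"

text \<open>Every finite poset has an isomorphic copy on a set of natural numbers. Quantifying over
  posets of natural numbers therefore covers all isomorphism classes, and forces \<open>'b\<close> to be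
  large enough to accommodate them.\<close>

definition rep_system :: "'b rel set \<Rightarrow> bool" where
  "rep_system \<PP> \<longleftrightarrow>
    (\<forall>P\<in>\<PP>. fin_poset P) \<and>
    (\<forall>P :: nat rel. fin_poset P \<longrightarrow> (\<exists>!P'. P' \<in> \<PP> \<and> poset_iso P P'))"

text \<open>Maps are extensional functions, so that equality of functions is equality of maps on
  \<open>Field P\<close> and injectivity on sets of maps has its usual meaning.\<close>

definition Hom :: "'a rel \<Rightarrow> 'b rel \<Rightarrow> ('a \<Rightarrow> 'b) set" where
  "Hom P Q = {\<xi> \<in> Field P \<rightarrow>\<^sub>E Field Q. \<forall>x y. (x, y) \<in> P \<longrightarrow> (\<xi> x, \<xi> y) \<in> Q}"

definition ord_sum :: "'a rel \<Rightarrow> 'a rel \<Rightarrow> 'a rel"  (infixr "\<oplus>" 65) where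
  "A \<oplus> B = A \<union> B \<union> Field A \<times> Field B"

definition strictly_comparable :: "'a rel \<Rightarrow> 'a \<Rightarrow> 'a \<Rightarrow> bool" where
  "strictly_comparable P x y \<longleftrightarrow> x \<noteq> y \<and> ((x, y) \<in> P \<or> (y, x) \<in> P)"

definition conn_comp :: "'a rel \<Rightarrow> 'a set \<Rightarrow> 'a \<Rightarrow> 'a set" where
  "conn_comp P A x =
    {y \<in> A. \<exists>(L :: nat) z. z 0 = x \<and> z L = y \<and> (\<forall>i\<le>L. z i \<in> A) \<and>
              (\<forall>i<L. strictly_comparable P (z i) (z (Suc i)))}"

definition G_comp :: "'a rel \<Rightarrow> ('a \<Rightarrow> 'b) \<Rightarrow> 'a \<Rightarrow> 'a set" where
  "G_comp P \<xi> x = conn_comp P {y \<in> Field P. \<xi> y = \<xi> x} x"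

definition hom_scheme ::
    "'p rel set \<Rightarrow> 'a rel \<Rightarrow> 'b rel \<Rightarrow> ('p rel \<Rightarrow> ('p \<Rightarrow> 'a) \<Rightarrow> ('p \<Rightarrow> 'b)) \<Rightarrow> bool" where
  "hom_scheme \<PP> R S \<rho> \<longleftrightarrow> (\<forall>P\<in>\<PP>. \<rho> P \<in> Hom P R \<rightarrow> Hom P S)"

definition strong_hom_scheme ::
    "'p rel set \<Rightarrow> 'a rel \<Rightarrow> 'b rel \<Rightarrow> ('p rel \<Rightarrow> ('p \<Rightarrow> 'a) \<Rightarrow> ('p \<Rightarrow> 'b)) \<Rightarrow> bool" where
  "strong_hom_scheme \<PP> R S \<rho> \<longleftrightarrow>
    hom_scheme \<PP> R S \<rho> \<and> (\<forall>P\<in>\<PP>. inj_on (\<rho> P) (Hom P R))"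

definition G_scheme ::
    "'p rel set \<Rightarrow> 'a rel \<Rightarrow> 'b rel \<Rightarrow> ('p rel \<Rightarrow> ('p \<Rightarrow> 'a) \<Rightarrow> ('p \<Rightarrow> 'b)) \<Rightarrow> bool" where
  "G_scheme \<PP> R S \<rho> \<longleftrightarrow>
    hom_scheme \<PP> R S \<rho> \<and>
    (\<forall>P\<in>\<PP>. \<forall>\<xi>\<in>Hom P R. \<forall>x\<in>Field P. G_comp P (\<rho> P \<xi>) x = G_comp P \<xi> x)"

definition G_le :: "'p rel set \<Rightarrow> 'a rel \<Rightarrow> 'b rel \<Rightarrow> bool" where
  "G_le \<PP> R S \<longleftrightarrow> (\<exists>\<rho>. strong_hom_scheme \<PP> R S \<rho> \<and> G_scheme \<PP> R S \<rho>)"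

lemma poset_iso_refl: "poset_iso P P"
  unfolding poset_iso_def by (rule exI[of _ id]) auto

lemma poset_iso_sym:
  assumes "poset_iso P Q"
  shows "poset_iso Q P"
proof -
  obtain f where f: "bij_betw f (Field P) (Field Q)"
    and iso: "\<forall>x\<in>Field P. \<forall>y\<in>Field P. (x, y) \<in> P \<longleftrightarrow> (f x, f y) \<in> Q"
    using assms unfolding poset_iso_def by blast
  let ?g = "inv_into (Field P) f"
  have g: "bij_betw ?g (Field Q) (Field P)"
    using f by (rule bij_betw_inv_into)
  have "(x, y) \<in> Q \<longleftrightarrow> (?g x, ?g y) \<in> P" if "x \<in> Field Q" "y \<in> Field Q" for x y
    using iso that bij_betw_apply[OF g] bij_betw_inv_into_right[OF f] by metis
  with g show ?thesis
    unfolding poset_iso_def by blast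
qed

lemma poset_iso_trans:
  assumes "poset_iso P Q" and "poset_iso Q R"
  shows "poset_iso P R"
proof -
  obtain f where f: "bij_betw f (Field P) (Field Q)"
    and fi: "\<forall>x\<in>Field P. \<forall>y\<in>Field P. (x, y) \<in> P \<longleftrightarrow> (f x, f y) \<in> Q"
    using assms(1) unfolding poset_iso_def by blast
  obtain g where g: "bij_betw g (Field Q) (Field R)"
    and gi: "\<forall>x\<in>Field Q. \<forall>y\<in>Field Q. (x, y) \<in> Q \<longleftrightarrow> (g x, g y) \<in> R"
    using assms(2) unfolding poset_iso_def by blast
  have "(x, y) \<in> P \<longleftrightarrow> ((g \<circ> f) x, (g \<circ> f) y) \<in> R" if "x \<in> Field P" "y \<in> Field P" for x y
    using fi gi that bij_betw_apply[OF f] by simp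
  with bij_betw_trans[OF f g] show ?thesis
    unfolding poset_iso_def by blast
qed

lemma rep_system_exists: "\<exists>\<PP> :: nat rel set. rep_system \<PP>"
proof -
  define c :: "nat rel \<Rightarrow> nat rel"
    where "c P = (SOME P'. fin_poset P' \<and> poset_iso P P')" for P
  have c: "fin_poset (c P) \<and> poset_iso P (c P)" if "fin_poset P" for P :: "nat rel"
    unfolding c_def by (rule someI[of _ P]) (use that poset_iso_refl in blast)
  have c_eq: "c P = c Q" if "poset_iso P Q" for P Q :: "nat rel"
  proof -
    have "poset_iso P P' \<longleftrightarrow> poset_iso Q P'" for P' :: "nat rel"
      using that poset_iso_sym poset_iso_trans by blast
    then show ?thesis
      by (simp add: c_def)
  qed
  have "\<exists>!P'. P' \<in> c ` Collect fin_poset \<and> poset_iso P P'" if "fin_poset P" for P :: "nat rel"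
  proof (rule ex1I[of _ "c P"])
    show "c P \<in> c ` Collect fin_poset \<and> poset_iso P (c P)"
      using c that by blast
  next
    fix P' assume "P' \<in> c ` Collect fin_poset \<and> poset_iso P P'"
    then obtain Q where "fin_poset Q" "P' = c Q" "poset_iso P (c Q)"
      by blast
    then have "poset_iso P Q"
      using c poset_iso_sym poset_iso_trans by blast
    then show "P' = c P"
      using \<open>P' = c Q\<close> c_eq by metis
  qed
  then have "rep_system (c ` Collect fin_poset)"
    unfolding rep_system_def using c by blast
  then show ?thesis ..
qed

end

theory Submission
  imports Defs
begin

text \<open>
  Whether two maps on \<open>P\<close> have the same \<open>G\<close>-components depends only on which comparable pairs they
  identify. Hence \<open>R \<sqsubseteq>\<^sub>G S\<close> amounts to inequalities between the numbers of
  homomorphisms identifying a prescribed set \<open>E\<close> of comparable pairs. Let \<open>h\<close> be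
  the maximal length of a chain in \<open>Q\<close>, and let \<open>X\<close> be the ordinal sum of an \<open>h\<close>-element chain
  and \<open>k\<close> disjoint copies of \<open>P\<close>. Homomorphisms from \<open>X\<close> to \<open>Q \<oplus> S\<close> that are strict
  on the chain and strict between chain and copies map all copies into \<open>S\<close>. If \<open>a\<close> and \<open>b\<close> are
  the numbers for \<open>(P, E)\<close> in \<open>R\<close> and in \<open>S\<close>, then counting the homomorphisms on \<open>X\<close>
  gives \<open>a ^ k \<le> c * b ^ k\<close> with \<open>c\<close> independent of \<open>k\<close>, whence \<open>a \<le> b\<close>.
\<close>

section \<open>Ties, G-components, and the counting form of the relation \<open>G_le\<close>\<close>

definition ties :: "'a rel \<Rightarrow> ('a \<Rightarrow> 'b) \<Rightarrow> 'a rel" where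
  "ties P \<xi> = {(x, y) \<in> P. \<xi> x = \<xi> y}"

definition tie_homs :: "'a rel \<Rightarrow> 'a rel \<Rightarrow> 'b rel \<Rightarrow> ('a \<Rightarrow> 'b) set" where
  "tie_homs P E R = {\<xi> \<in> Hom P R. ties P \<xi> = E}"

lemma HomI:
  assumes "\<And>x. x \<notin> Field P \<Longrightarrow> \<xi> x = undefined"
    and "\<And>x. x \<in> Field P \<Longrightarrow> \<xi> x \<in> Field R"
    and "\<And>x y. (x, y) \<in> P \<Longrightarrow> (\<xi> x, \<xi> y) \<in> R"
  shows "\<xi> \<in> Hom P R"
  using assms by (auto simp: Hom_def PiE_def extensional_def)

lemma Hom_mono: "\<xi> \<in> Hom P R \<Longrightarrow> (x, y) \<in> P \<Longrightarrow> (\<xi> x, \<xi> y) \<in> R"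
  by (simp add: Hom_def)

lemma Hom_Field: "\<xi> \<in> Hom P R \<Longrightarrow> x \<in> Field P \<Longrightarrow> \<xi> x \<in> Field R"
  by (auto simp: Hom_def)

lemma Hom_undefined: "\<xi> \<in> Hom P R \<Longrightarrow> x \<notin> Field P \<Longrightarrow> \<xi> x = undefined"
  by (auto simp: Hom_def PiE_def extensional_def)

lemma Hom_ext:
  assumes "\<xi> \<in> Hom P R" "\<zeta> \<in> Hom P R" "\<And>x. x \<in> Field P \<Longrightarrow> \<xi> x = \<zeta> x"
  shows "\<xi> = \<zeta>"
  using assms by (metis Hom_undefined ext)

lemma finite_Hom:
  assumes "finite (Field P)" "finite (Field R)"
  shows "finite (Hom P R)"
proof (rule finite_subset)
  show "Hom P R \<subseteq> Field P \<rightarrow>\<^sub>E Field R" by (auto simp: Hom_def)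
  show "finite (Field P \<rightarrow>\<^sub>E Field R)" using assms by (intro finite_PiE) auto
qed

lemma finite_tie_homs:
  "finite (Field P) \<Longrightarrow> finite (Field R) \<Longrightarrow> finite (tie_homs P E R)"
  unfolding tie_homs_def by (rule finite_subset[OF _ finite_Hom]) auto

text \<open>A tie is a comparable pair inside a fibre. A path inside the fibre of \<open>x\<close>
  therefore runs along ties, and a walk along ties keeps the value and never leaves that fibre. So
  G-components are the connected components of the graph of ties.\<close>

lemma G_comp_eq_rtrancl:
  assumes "x \<in> Field P"
  shows "G_comp P \<xi> x = (ties P \<xi> \<union> (ties P \<xi>)\<inverse>)\<^sup>* `` {x}" (is "_ = ?T\<^sup>* `` {x}")
proof (intro equalityI subsetI)
  fix y assume "y \<in> G_comp P \<xi> x"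
  then obtain L z where z: "z 0 = x" "z L = y" "\<forall>i\<le>L. z i \<in> Field P \<and> \<xi> (z i) = \<xi> x"
    "\<forall>i<L. strictly_comparable P (z i) (z (Suc i))"
    unfolding G_comp_def conn_comp_def by auto
  have "(x, z i) \<in> ?T\<^sup>*" if "i \<le> L" for i
    using that
  proof (induction i)
    case 0
    then show ?case using z(1) by simp
  next
    case (Suc i)
    have "\<xi> (z i) = \<xi> (z (Suc i))" using z(3) Suc.prems by (metis Suc_leD)
    then have "(z i, z (Suc i)) \<in> ?T"
      using z(4) Suc.prems by (auto simp: strictly_comparable_def ties_def)
    then show ?case using Suc by (meson Suc_leD rtrancl.rtrancl_into_rtrancl)
  qed
  then show "y \<in> ?T\<^sup>* `` {x}" using z(2) by auto
next
  fix y assume "y \<in> ?T\<^sup>* `` {x}"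
  then have "(x, y) \<in> ?T\<^sup>*" by simp
  then show "y \<in> G_comp P \<xi> x"
  proof (induction rule: rtrancl_induct)
    case base
    show ?case unfolding G_comp_def conn_comp_def
      using assms by (auto intro!: exI[of _ "0::nat"] exI[of _ "\<lambda>_. x"])
  next
    case (step u v)
    show ?case
    proof (cases "u = v")
      \<comment> \<open>\<open>ties\<close> may contain reflexive pairs, whereas consecutive
        elements of a path must be strictly comparable. A step that stands still is dropped.\<close>
      case True
      then show ?thesis using step by simp
    next
      case False
      from step(3) obtain L z where z: "z 0 = x" "z L = u"
        "\<forall>i\<le>L. z i \<in> Field P \<and> \<xi> (z i) = \<xi> x"
        "\<forall>i<L. strictly_comparable P (z i) (z (Suc i))"
        unfolding G_comp_def conn_comp_def by auto
      have v: "v \<in> Field P" "\<xi> v = \<xi> x" "strictly_comparable P u v"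
        using step(2) False z(2,3)
        by (auto simp: ties_def strictly_comparable_def intro: FieldI1 FieldI2)
      define w where "w = z(Suc L := v)"
      have "w 0 = x" "w (Suc L) = v" "\<forall>i\<le>Suc L. w i \<in> Field P \<and> \<xi> (w i) = \<xi> x"
        "\<forall>i<Suc L. strictly_comparable P (w i) (w (Suc i))"
        using z v by (auto simp: w_def less_Suc_eq le_Suc_eq)
      then show ?thesis unfolding G_comp_def conn_comp_def using v by blast
    qed
  qed
qed

lemma G_comp_const: "y \<in> G_comp P \<xi> x \<Longrightarrow> \<xi> y = \<xi> x"
  by (auto simp: G_comp_def conn_comp_def)

text \<open>The two ends of a tie of \<open>\<xi>\<close> lie in one G-component of
  \<open>\<xi>\<close>, hence in one of \<open>\<zeta>\<close>, and \<open>\<zeta>\<close> is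
  constant on its components.\<close>

lemma ties_subset_if_G_comp_eq:
  assumes "\<forall>x\<in>Field P. G_comp P \<xi> x = G_comp P \<zeta> x"
  shows "ties P \<xi> \<subseteq> ties P \<zeta>"
proof
  fix e assume "e \<in> ties P \<xi>"
  then obtain x y where e: "e = (x, y)" "(x, y) \<in> P" "(x, y) \<in> ties P \<xi>"
    by (auto simp: ties_def)
  then have x: "x \<in> Field P" by (auto intro: FieldI1)
  then have "y \<in> G_comp P \<xi> x" using e by (auto simp: G_comp_eq_rtrancl)
  then have "\<zeta> y = \<zeta> x" using assms x G_comp_const by metis
  then show "e \<in> ties P \<zeta>" using e by (simp add: ties_def)
qed

lemma G_comp_eq_iff_ties_eq:
  "(\<forall>x\<in>Field P. G_comp P \<xi> x = G_comp P \<zeta> x) \<longleftrightarrow> ties P \<xi> = ties P \<zeta>"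
  using ties_subset_if_G_comp_eq[of P \<xi> \<zeta>] ties_subset_if_G_comp_eq[of P \<zeta> \<xi>]
  by (auto simp: G_comp_eq_rtrancl)

text \<open>The sets \<open>tie_homs P E R\<close>, for varying \<open>E\<close>, partition
  \<open>Hom P R\<close>, and the G-scheme condition says exactly that \<open>\<rho> P\<close> maps
  each block into the block of \<open>S\<close> with the same \<open>E\<close>. Nothing links
  different \<open>P\<close> or different \<open>E\<close>, so the injections can be chosen block by
  block, and between finite blocks they exist exactly if the cardinalities allow it.\<close>

lemma G_le_iff_card_tie_homs:
  assumes fin: "\<And>P. P \<in> \<PP> \<Longrightarrow> finite (Field P)" "finite (Field R)" "finite (Field S)"
  shows "G_le \<PP> R S \<longleftrightarrow> (\<forall>P\<in>\<PP>. \<forall>E. card (tie_homs P E R) \<le> card (tie_homs P E S))"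
proof
  assume "G_le \<PP> R S"
  then obtain \<rho> where \<rho>: "strong_hom_scheme \<PP> R S \<rho>" "G_scheme \<PP> R S \<rho>"
    by (auto simp: G_le_def)
  show "\<forall>P\<in>\<PP>. \<forall>E. card (tie_homs P E R) \<le> card (tie_homs P E S)"
  proof (intro ballI allI)
    fix P E assume P: "P \<in> \<PP>"
    have maps: "\<rho> P \<xi> \<in> Hom P S" "ties P (\<rho> P \<xi>) = ties P \<xi>" if "\<xi> \<in> Hom P R" for \<xi>
      using \<rho> P that G_comp_eq_iff_ties_eq[of P "\<rho> P \<xi>" \<xi>]
      by (auto simp: G_scheme_def hom_scheme_def)
    show "card (tie_homs P E R) \<le> card (tie_homs P E S)"
    proof (rule card_inj_on_le)
      show "inj_on (\<rho> P) (tie_homs P E R)"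
        using \<rho>(1) P by (auto simp: strong_hom_scheme_def tie_homs_def intro: inj_on_subset)
      show "\<rho> P ` tie_homs P E R \<subseteq> tie_homs P E S"
        using maps by (auto simp: tie_homs_def)
      show "finite (tie_homs P E S)" using fin P by (simp add: finite_tie_homs)
    qed
  qed
next
  assume le: "\<forall>P\<in>\<PP>. \<forall>E. card (tie_homs P E R) \<le> card (tie_homs P E S)"
  have "\<forall>P E. \<exists>f. P \<in> \<PP> \<longrightarrow> f ` tie_homs P E R \<subseteq> tie_homs P E S \<and> inj_on f (tie_homs P E R)"
    using le fin by (metis card_le_inj finite_tie_homs)
  then obtain f where
    f: "\<And>P E. P \<in> \<PP> \<Longrightarrow> f P E ` tie_homs P E R \<subseteq> tie_homs P E S \<and> inj_on (f P E) (tie_homs P E R)"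
    by metis
  define \<rho> where "\<rho> P \<xi> = f P (ties P \<xi>) \<xi>" for P \<xi>
  have maps: "\<rho> P \<xi> \<in> Hom P S" "ties P (\<rho> P \<xi>) = ties P \<xi>" if "P \<in> \<PP>" "\<xi> \<in> Hom P R" for P \<xi>
    using f[OF that(1), of "ties P \<xi>"] that(2) by (auto simp: \<rho>_def tie_homs_def)
  have hs: "hom_scheme \<PP> R S \<rho>" using maps by (auto simp: hom_scheme_def)
  have "inj_on (\<rho> P) (Hom P R)" if P: "P \<in> \<PP>" for P
  proof (rule inj_onI)
    fix \<xi> \<zeta> assume *: "\<xi> \<in> Hom P R" "\<zeta> \<in> Hom P R" "\<rho> P \<xi> = \<rho> P \<zeta>"
    \<comment> \<open>Maps from different blocks cannot collide, because the common image determines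
      the ties. What remains is injectivity within one block.\<close>
    then have t: "ties P \<zeta> = ties P \<xi>" using maps P by metis
    show "\<xi> = \<zeta>"
      using f[OF P, of "ties P \<xi>"] * t by (auto simp: \<rho>_def tie_homs_def dest: inj_onD)
  qed
  moreover have "G_scheme \<PP> R S \<rho>"
    unfolding G_scheme_def using hs maps(2) G_comp_eq_iff_ties_eq by metis
  ultimately show "G_le \<PP> R S"
    using hs unfolding G_le_def strong_hom_scheme_def by blast
qed

section \<open>Transfer from the representatives to finite posets of arbitrary type\<close>

lemma card_tie_homs_iso_le:
  assumes f: "bij_betw f (Field X) (Field Y)"
    and iso: "\<And>x y. x \<in> Field X \<Longrightarrow> y \<in> Field X \<Longrightarrow> (x, y) \<in> X \<longleftrightarrow> (f x, f y) \<in> Y"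
    and fin: "finite (Field X)" "finite (Field R)"
  shows "card (tie_homs Y E R) \<le> card (tie_homs X {(x, y) \<in> X. (f x, f y) \<in> E} R)"
proof (rule card_inj_on_le)
  let ?\<Phi> = "\<lambda>\<zeta>. restrict (\<zeta> \<circ> f) (Field X)"
  have fX: "f x \<in> Field Y" if "x \<in> Field X" for x using f that by (rule bij_betw_apply)
  have fi: "x \<in> Field X \<and> y \<in> Field X \<and> (f x, f y) \<in> Y" if "(x, y) \<in> X" for x y
    using that iso by (blast intro: FieldI1 FieldI2)
  show "inj_on ?\<Phi> (tie_homs Y E R)"
  proof (rule inj_onI)
    fix \<xi> \<zeta> assume *: "\<xi> \<in> tie_homs Y E R" "\<zeta> \<in> tie_homs Y E R" "?\<Phi> \<xi> = ?\<Phi> \<zeta>"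
    have "\<xi> y = \<zeta> y" if y: "y \<in> Field Y" for y
    proof -
      obtain x where "x \<in> Field X" "y = f x" using f y by (auto simp: bij_betw_def)
      then show ?thesis using fun_cong[OF *(3), of x] by simp
    qed
    then show "\<xi> = \<zeta>" using * Hom_ext[of \<xi> Y R \<zeta>] by (auto simp: tie_homs_def)
  qed
  show "?\<Phi> ` tie_homs Y E R \<subseteq> tie_homs X {(x, y) \<in> X. (f x, f y) \<in> E} R"
  proof
    fix \<eta> assume "\<eta> \<in> ?\<Phi> ` tie_homs Y E R"
    then obtain \<zeta> where \<zeta>: "\<eta> = ?\<Phi> \<zeta>" "\<zeta> \<in> Hom Y R" "ties Y \<zeta> = E" by (auto simp: tie_homs_def)
    have "\<eta> \<in> Hom X R"
      by (rule HomI) (use \<zeta> fX fi in \<open>auto intro: Hom_Field Hom_mono\<close>)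
    moreover have "ties X \<eta> = {(x, y) \<in> X. (f x, f y) \<in> E}"
      using \<zeta>(1) fi unfolding \<zeta>(3)[symmetric] ties_def by auto
    ultimately show "\<eta> \<in> tie_homs X {(x, y) \<in> X. (f x, f y) \<in> E} R" by (simp add: tie_homs_def)
  qed
  show "finite (tie_homs X {(x, y) \<in> X. (f x, f y) \<in> E} R)" using fin by (rule finite_tie_homs)
qed

lemma ties_subset: "ties P \<xi> \<subseteq> P"
  by (auto simp: ties_def)

text \<open>Composition with an isomorphism is injective on homomorphisms and pulls their ties back.
  Doing this along \<open>f\<close> and along its inverse gives the two inequalities;
  \<open>E \<subseteq> Y\<close> ensures that pulling back twice returns \<open>E\<close>.\<close>

lemma card_tie_homs_iso:
  assumes f: "bij_betw f (Field X) (Field Y)"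
    and iso: "\<And>x y. x \<in> Field X \<Longrightarrow> y \<in> Field X \<Longrightarrow> (x, y) \<in> X \<longleftrightarrow> (f x, f y) \<in> Y"
    and fin: "finite (Field X)" "finite (Field R)" and E: "E \<subseteq> Y"
  shows "card (tie_homs Y E R) = card (tie_homs X {(x, y) \<in> X. (f x, f y) \<in> E} R)"
proof (rule antisym)
  show "card (tie_homs Y E R) \<le> card (tie_homs X {(x, y) \<in> X. (f x, f y) \<in> E} R)"
    using f iso fin by (rule card_tie_homs_iso_le)
  let ?g = "inv_into (Field X) f" and ?D = "{(x, y) \<in> X. (f x, f y) \<in> E}"
  have g: "bij_betw ?g (Field Y) (Field X)" using f by (rule bij_betw_inv_into)
  have fg: "f (?g y) = y" if "y \<in> Field Y" for y using f that by (rule bij_betw_inv_into_right)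
  have gY: "?g y \<in> Field X" if "y \<in> Field Y" for y using g that by (rule bij_betw_apply)
  have iso': "(x, y) \<in> Y \<longleftrightarrow> (?g x, ?g y) \<in> X" if "x \<in> Field Y" "y \<in> Field Y" for x y
    using iso fg gY that by simp
  have "finite (Field Y)" using f fin bij_betw_finite by auto
  then have "card (tie_homs X ?D R) \<le> card (tie_homs Y {(x, y) \<in> Y. (?g x, ?g y) \<in> ?D} R)"
    using card_tie_homs_iso_le[OF g iso'] fin by blast
  also have "{(x, y) \<in> Y. (?g x, ?g y) \<in> ?D} = E"
  proof -
    have "(?g x, ?g y) \<in> ?D \<longleftrightarrow> (x, y) \<in> E" if "(x, y) \<in> Y" for x y
      using that iso' fg FieldI1[OF that] FieldI2[OF that] by auto
    then show ?thesis using E by auto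
  qed
  finally show "card (tie_homs X ?D R) \<le> card (tie_homs Y E R)" .
qed

text \<open>\<open>rep_system\<close> promises representatives for posets of natural numbers only.
  Carrying the order along an injection of the finite carrier into \<open>nat\<close> brings every
  finite poset within its reach.\<close>

lemma fin_poset_nat_copy:
  fixes X :: "'c rel"
  assumes "fin_poset X"
  shows "\<exists>Y :: nat rel. fin_poset Y \<and> poset_iso X Y"
proof -
  from assms have X: "refl_on (Field X) X" "trans X" "antisym X" "finite (Field X)" "Field X \<noteq> {}"
    by (auto simp: fin_poset_def order_on_defs)
  obtain f :: "'c \<Rightarrow> nat" where f: "inj_on f (Field X)"
    using X(4) finite_imp_inj_to_nat_seg by blast
  define Y where "Y = map_prod f f ` X"
  have inX: "x \<in> Field X \<and> y \<in> Field X" if "(x, y) \<in> X" for x y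
    using that by (blast intro: FieldI1 FieldI2)
  have F: "Field Y = f ` Field X"
    by (force simp: Y_def Field_def)
  have FieldY: "a \<in> f ` Field X \<and> b \<in> f ` Field X" if "(a, b) \<in> Y" for a b
    using that unfolding F[symmetric] by (blast intro: FieldI1 FieldI2)
  have iff: "(f x, f y) \<in> Y \<longleftrightarrow> (x, y) \<in> X" if "x \<in> Field X" "y \<in> Field X" for x y
  proof
    assume "(f x, f y) \<in> Y"
    then obtain u v where "(u, v) \<in> X" "f x = f u" "f y = f v" by (auto simp: Y_def)
    then show "(x, y) \<in> X" using inX[of u v] that inj_on_eq_iff[OF f] by simp
  next
    assume "(x, y) \<in> X"
    then have "map_prod f f (x, y) \<in> Y" unfolding Y_def by (rule imageI)
    then show "(f x, f y) \<in> Y" by simp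
  qed
  have "refl_on (Field Y) Y" using X(1) iff unfolding F refl_on_def by auto
  moreover have "trans Y"
  proof (rule transI)
    fix a b c assume "(a, b) \<in> Y" "(b, c) \<in> Y"
    then obtain x y z where "a = f x" "b = f y" "c = f z" "x \<in> Field X" "y \<in> Field X" "z \<in> Field X"
      using FieldY by blast
    then show "(a, c) \<in> Y"
      using \<open>(a, b) \<in> Y\<close> \<open>(b, c) \<in> Y\<close> transD[OF X(2), of x y z] by (simp add: iff)
  qed
  moreover have "antisym Y"
  proof (rule antisymI)
    fix a b assume "(a, b) \<in> Y" "(b, a) \<in> Y"
    then obtain x y where "a = f x" "b = f y" "x \<in> Field X" "y \<in> Field X"
      using FieldY by blast
    then show "a = b"
      using \<open>(a, b) \<in> Y\<close> \<open>(b, a) \<in> Y\<close> antisymD[OF X(3), of x y] by (simp add: iff)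
  qed
  moreover have "Y \<subseteq> Field Y \<times> Field Y" by (auto intro: FieldI1 FieldI2)
  ultimately have "fin_poset Y" using X(4,5) by (auto simp: fin_poset_def order_on_defs F)
  moreover have "poset_iso X Y"
    unfolding poset_iso_def using f iff F by (auto simp: bij_betw_def)
  ultimately show ?thesis by blast
qed

text \<open>The poset to be tested need not be a representative, nor even have the element type of
  \<open>\<PP>\<close>. Its counts agree with those of its representative, where the inequality is
  available.\<close>

lemma G_le_card_tie_homs_le:
  fixes X :: "'c rel"
  assumes rep: "rep_system \<PP>" and le: "G_le \<PP> R S" and X: "fin_poset X"
    and fin: "finite (Field R)" "finite (Field S)"
  shows "card (tie_homs X E R) \<le> card (tie_homs X E S)"
proof (cases "E \<subseteq> X")
  case True
  obtain P where P: "P \<in> \<PP>" "poset_iso X P"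
    using fin_poset_nat_copy[OF X] rep poset_iso_trans unfolding rep_system_def by blast
  then obtain f where f: "bij_betw f (Field P) (Field X)"
    and iso: "\<And>x y. x \<in> Field P \<Longrightarrow> y \<in> Field P \<Longrightarrow> (x, y) \<in> P \<longleftrightarrow> (f x, f y) \<in> X"
    using poset_iso_sym[OF P(2)] unfolding poset_iso_def by blast
  have finP: "finite (Field P)" if "P \<in> \<PP>" for P
    using rep that by (auto simp: rep_system_def fin_poset_def)
  let ?D = "{(x, y) \<in> P. (f x, f y) \<in> E}"
  have "card (tie_homs X E R) = card (tie_homs P ?D R)"
    using f iso finP[OF P(1)] fin(1) True by (rule card_tie_homs_iso)
  also have "\<dots> \<le> card (tie_homs P ?D S)"
    using G_le_iff_card_tie_homs[of \<PP> R S] finP fin le P(1) by blast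
  also have "\<dots> = card (tie_homs X E S)"
    using f iso finP[OF P(1)] fin(2) True by (rule card_tie_homs_iso[symmetric])
  finally show ?thesis .
next
  case False
  then have "tie_homs X E R = {}" using ties_subset by (fastforce simp: tie_homs_def)
  then show ?thesis by simp
qed

section \<open>Longest chains, and the test poset made of a chain below copies of
  \<open>P\<close>\<close>

definition strict_chain :: "'a rel \<Rightarrow> nat \<Rightarrow> (nat \<Rightarrow> 'a) \<Rightarrow> bool" where
  "strict_chain Q h c \<longleftrightarrow>
    (\<forall>i<h. c i \<in> Field Q) \<and> (\<forall>i j. i < j \<longrightarrow> j < h \<longrightarrow> (c i, c j) \<in> Q \<and> c i \<noteq> c j)"

text \<open>A strict chain is injective, so its number of elements \<open>h\<close> is at most the
  size of the carrier. The empty chain shows that some length occurs, hence there is a greatest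
  one.\<close>

lemma longest_strict_chain:
  assumes "finite (Field Q)"
  obtains h c where "strict_chain Q h c" "\<And>d. \<not> strict_chain Q (Suc h) d"
proof -
  have bound: "h \<le> card (Field Q)" if "strict_chain Q h c" for h c
  proof -
    have "inj_on c {..<h}"
      using that unfolding strict_chain_def inj_on_def by (metis lessThan_iff linorder_neqE_nat)
    moreover have "c ` {..<h} \<subseteq> Field Q" using that by (auto simp: strict_chain_def)
    ultimately show ?thesis using card_inj_on_le assms by fastforce
  qed
  have "\<exists>c. strict_chain Q 0 c" by (simp add: strict_chain_def)
  then obtain h where "\<exists>c. strict_chain Q h c" "\<And>h'. \<exists>c. strict_chain Q h' c \<Longrightarrow> h' \<le> h"
    using Greatest_le_nat[of "\<lambda>h. \<exists>c. strict_chain Q h c" _ "card (Field Q)"]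
      GreatestI_nat[of "\<lambda>h. \<exists>c. strict_chain Q h c" 0 "card (Field Q)"] bound by blast
  then show ?thesis using that by (metis Suc_n_not_le_n)
qed

text \<open>The ordinal sum of an \<open>h\<close>-element chain and \<open>k\<close> disjoint
  copies of \<open>P\<close>. The sum type keeps the two parts apart, and the index \<open>j\<close>
  in \<open>Inr (j, p)\<close> names the copy.\<close>

definition chain_copies :: "nat \<Rightarrow> nat \<Rightarrow> 'p rel \<Rightarrow> (nat + nat \<times> 'p) rel" where
  "chain_copies h k P =
    {(Inl i, Inl j) | i j. i \<le> j \<and> j < h} \<union>
    {(Inl i, Inr (j, p)) | i j p. i < h \<and> j < k \<and> p \<in> Field P} \<union>
    {(Inr (j, p), Inr (j, q)) | j p q. j < k \<and> (p, q) \<in> P}"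

text \<open>As a prescribed set of ties, this demands strictness along the chain and between chain
  and copies, and the ties \<open>E\<close> in every copy.\<close>

definition copies_ties :: "nat \<Rightarrow> nat \<Rightarrow> 'p rel \<Rightarrow> (nat + nat \<times> 'p) rel" where
  "copies_ties h k E =
    {(Inl i, Inl i) | i. i < h} \<union> {(Inr (j, p), Inr (j, q)) | j p q. j < k \<and> (p, q) \<in> E}"

lemma chain_copies_simps [simp]:
  "(Inl i, Inl j) \<in> chain_copies h k P \<longleftrightarrow> i \<le> j \<and> j < h"
  "(Inl i, Inr (j, p)) \<in> chain_copies h k P \<longleftrightarrow> i < h \<and> j < k \<and> p \<in> Field P"
  "(Inr x, Inl i) \<notin> chain_copies h k P"
  "(Inr (j, p), Inr (j', q)) \<in> chain_copies h k P \<longleftrightarrow> j' = j \<and> j < k \<and> (p, q) \<in> P"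
  by (auto simp: chain_copies_def)

lemma chain_copies_cases:
  assumes "(x, y) \<in> chain_copies h k P"
  obtains i j where "x = Inl i" "y = Inl j" "i \<le> j" "j < h"
  | i j p where "x = Inl i" "y = Inr (j, p)" "i < h" "j < k" "p \<in> Field P"
  | j p q where "x = Inr (j, p)" "y = Inr (j, q)" "j < k" "(p, q) \<in> P"
  using assms unfolding chain_copies_def by blast

lemma copies_ties_simps [simp]:
  "(Inl i, Inl j) \<in> copies_ties h k P \<longleftrightarrow> i = j \<and> i < h"
  "(Inl i, Inr x) \<notin> copies_ties h k P"
  "(Inr x, Inl i) \<notin> copies_ties h k P"
  "(Inr (j, p), Inr (j', q)) \<in> copies_ties h k P \<longleftrightarrow> j' = j \<and> j < k \<and> (p, q) \<in> P"
  by (auto simp: copies_ties_def)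

lemma Field_chain_copies: "Field (chain_copies h k P) = Inl ` {..<h} \<union> Inr ` ({..<k} \<times> Field P)"
proof (intro equalityI subsetI)
  fix x assume "x \<in> Field (chain_copies h k P)"
  then show "x \<in> Inl ` {..<h} \<union> Inr ` ({..<k} \<times> Field P)"
    unfolding chain_copies_def by (fastforce simp: Field_def)
next
  fix x assume "x \<in> Inl ` {..<h} \<union> Inr ` ({..<k} \<times> Field P)"
  then consider i where "x = Inl i" "i < h" | j p where "x = Inr (j, p)" "j < k" "p \<in> Field P"
    by auto
  then show "x \<in> Field (chain_copies h k P)"
  proof cases
    case 1
    then have "(x, x) \<in> chain_copies h k P" by simp
    then show ?thesis by (rule FieldI1)
  next
    case 2
    then obtain q where "(p, q) \<in> P \<or> (q, p) \<in> P" by (auto simp: Field_def)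
    then have "(x, Inr (j, q)) \<in> chain_copies h k P \<or> (Inr (j, q), x) \<in> chain_copies h k P"
      using 2 by simp
    then show ?thesis by (auto intro: FieldI1 FieldI2)
  qed
qed

lemma fin_poset_chain_copies:
  assumes "fin_poset P" "k > 0"
  shows "fin_poset (chain_copies h k P)" (is "fin_poset ?X")
proof -
  from assms have P: "refl_on (Field P) P" "trans P" "antisym P" "finite (Field P)" "Field P \<noteq> {}"
    by (auto simp: fin_poset_def order_on_defs)
  have F: "x \<in> Field P \<and> y \<in> Field P" if "(x, y) \<in> P" for x y
    using that by (blast intro: FieldI1 FieldI2)
  have "refl_on (Field ?X) ?X"
    using P(1) by (auto simp: refl_on_def Field_chain_copies)
  moreover have "trans ?X"
  proof (rule transI)
    fix x y z assume "(x, y) \<in> ?X" "(y, z) \<in> ?X"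
    then show "(x, z) \<in> ?X"
      using transD[OF P(2)] F
      by (cases x; cases y; cases z) (auto)
  qed
  moreover have "antisym ?X"
  proof (rule antisymI)
    fix x y assume "(x, y) \<in> ?X" "(y, x) \<in> ?X"
    then show "x = y" using antisymD[OF P(3)] by (cases x; cases y) auto
  qed
  moreover have "?X \<subseteq> Field ?X \<times> Field ?X" by (auto intro: FieldI1 FieldI2)
  moreover have "finite (Field ?X)" "Field ?X \<noteq> {}"
    using P(4,5) assms(2) by (auto simp: Field_chain_copies)
  ultimately show ?thesis by (simp add: fin_poset_def order_on_defs)
qed

section \<open>Lower and upper bounds for the counts on the test poset\<close>

lemma Field_ord_sum: "Field (A \<oplus> B) = Field A \<union> Field B"
  by (auto simp: ord_sum_def Field_def)

lemma ord_sum_left: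
  assumes "Field A \<inter> Field B = {}" "(x, y) \<in> A \<oplus> B" "y \<in> Field A"
  shows "(x, y) \<in> A"
  using assms by (auto simp: ord_sum_def dest: FieldI1 FieldI2)

lemma ord_sum_right:
  assumes "Field A \<inter> Field B = {}" "(x, y) \<in> A \<oplus> B" "x \<in> Field B"
  shows "(x, y) \<in> B"
  using assms by (auto simp: ord_sum_def dest: FieldI1 FieldI2)

text \<open>Place the chain on a fixed strict chain in \<open>Q\<close> and choose the maps from the
  \<open>k\<close> copies into \<open>R\<close> independently. Different copies are incomparable, so
  neither monotonicity nor ties relate them, and each choice can be read off from its copy.\<close>

lemma card_tie_homs_power_le:
  assumes Q: "strict_chain Q h c" "refl_on (Field Q) Q"
    and disj: "Field Q \<inter> Field R = {}"
    and fin: "finite (Field P)" "finite (Field Q)" "finite (Field R)"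
  shows "card (tie_homs P E R) ^ k
    \<le> card (tie_homs (chain_copies h k P) (copies_ties h k E) (Q \<oplus> R))"
proof -
  let ?A = "{..<k} \<rightarrow>\<^sub>E tie_homs P E R" and ?X = "chain_copies h k P" and ?E = "copies_ties h k E"
  define \<Phi> where "\<Phi> F = (\<lambda>x. case x of Inl i \<Rightarrow> if i < h then c i else undefined
      | Inr (j, p) \<Rightarrow> if j < k \<and> p \<in> Field P then F j p else undefined)"
    for F :: "nat \<Rightarrow> 'b \<Rightarrow> 'a"
  have \<Phi>_simps: "\<Phi> F (Inl i) = (if i < h then c i else undefined)"
    "\<Phi> F (Inr (j, p)) = (if j < k \<and> p \<in> Field P then F j p else undefined)" for F i j p
    by (simp_all add: \<Phi>_def)
  have "card (tie_homs P E R) ^ k = card ?A" by (simp add: card_funcsetE)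
  also have "\<dots> \<le> card (tie_homs ?X ?E (Q \<oplus> R))"
  proof (rule card_inj_on_le)
    show "inj_on \<Phi> ?A"
    proof (rule inj_onI)
      fix F G assume *: "F \<in> ?A" "G \<in> ?A" "\<Phi> F = \<Phi> G"
      show "F = G"
      proof (rule PiE_ext[OF *(1,2)])
        fix j assume j: "j \<in> {..<k}"
        then have "F j \<in> Hom P R" "G j \<in> Hom P R" using * by (auto simp: tie_homs_def)
        moreover have "F j p = G j p" if "p \<in> Field P" for p
          using fun_cong[OF *(3), of "Inr (j, p)"] j that by (simp add: \<Phi>_simps)
        ultimately show "F j = G j" by (rule Hom_ext)
      qed
    qed
    show "\<Phi> ` ?A \<subseteq> tie_homs ?X ?E (Q \<oplus> R)"
    proof
      fix \<eta> assume "\<eta> \<in> \<Phi> ` ?A"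
      then obtain F where F: "\<eta> = \<Phi> F" "\<And>j. j < k \<Longrightarrow> F j \<in> Hom P R"
        "\<And>j. j < k \<Longrightarrow> ties P (F j) = E" by (auto simp: tie_homs_def PiE_def Pi_def)
      have FR: "F j p \<in> Field R" if "j < k" "p \<in> Field P" for j p
        using F(2) that by (blast intro: Hom_Field)
      have PF: "p \<in> Field P \<and> q \<in> Field P" if "(p, q) \<in> P" for p q
        using that by (blast intro: FieldI1 FieldI2)
      have c: "c i \<in> Field Q" if "i < h" for i using Q(1) that by (simp add: strict_chain_def)
      have c_le: "(c i, c j) \<in> Q" if "i \<le> j" "j < h" for i j
        using Q that c[of i] by (cases "i = j") (auto simp: strict_chain_def refl_on_def)
      have c_inj: "i = j" if "c i = c j" "i \<le> j" "j < h" for i j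
        using Q(1) that unfolding strict_chain_def by (metis le_neq_implies_less)
      have "\<eta> \<in> Hom ?X (Q \<oplus> R)"
      proof (rule HomI)
        fix x assume "x \<notin> Field ?X"
        then show "\<eta> x = undefined" unfolding F(1) Field_chain_copies
          by (cases x) (auto simp: \<Phi>_simps)
      next
        fix x assume "x \<in> Field ?X"
        then show "\<eta> x \<in> Field (Q \<oplus> R)" unfolding F(1) Field_chain_copies Field_ord_sum
          using c FR by (auto simp: \<Phi>_simps)
      next
        fix x y assume "(x, y) \<in> ?X"
        then show "(\<eta> x, \<eta> y) \<in> Q \<oplus> R"
        proof (cases rule: chain_copies_cases)
          case 1
          then show ?thesis using c_le by (simp add: F(1) \<Phi>_simps ord_sum_def)
        next
          case 2
          then show ?thesis using c FR by (simp add: F(1) \<Phi>_simps ord_sum_def)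
        next
          case 3
          then show ?thesis using Hom_mono[OF F(2)] PF[OF 3(4)]
            by (simp add: F(1) \<Phi>_simps ord_sum_def)
        qed
      qed
      moreover have "ties ?X \<eta> = ?E"
      proof -
        have E: "(p, q) \<in> E \<longleftrightarrow> (p, q) \<in> P \<and> F j p = F j q" if "j < k" for j p q
          using F(3)[OF that] by (auto simp: ties_def)
        \<comment> \<open>Chain values lie in \<open>Q\<close> and copy values in \<open>R\<close>,
          so disjointness rules out ties between them.\<close>
        have ne: "c i \<noteq> F j p" if "i < h" "j < k" "p \<in> Field P" for i j p
          using c[OF that(1)] FR[OF that(2,3)] disj by auto
        have "(\<Phi> F x = \<Phi> F y) = ((x, y) \<in> ?E)" if "(x, y) \<in> ?X" for x y
          using that
        proof (cases rule: chain_copies_cases)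
          case 1
          then show ?thesis using c_inj by (auto simp: \<Phi>_simps)
        next
          case 2
          then show ?thesis using ne by (simp add: \<Phi>_simps)
        next
          case 3
          then show ?thesis using E[OF 3(3)] PF[OF 3(4)] by (simp add: \<Phi>_simps)
        qed
        moreover have "?E \<subseteq> ?X"
        proof -
          have "(p, q) \<in> P" if "j < k" "(p, q) \<in> E" for j p q
            using E[OF that(1)] that(2) by blast
          then show ?thesis by (auto simp: copies_ties_def)
        qed
        ultimately show ?thesis unfolding F(1) ties_def by blast
      qed
      ultimately show "\<eta> \<in> tie_homs ?X ?E (Q \<oplus> R)" by (simp add: tie_homs_def)
    qed
    show "finite (tie_homs ?X ?E (Q \<oplus> R))"
      using fin by (intro finite_tie_homs) (auto simp: Field_chain_copies Field_ord_sum)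
  qed
  finally show ?thesis .
qed

text \<open>Since no chain in \<open>Q\<close> has \<open>h + 1\<close> elements, every copy is
  forced into \<open>S\<close>. A homomorphism is thus determined by \<open>h\<close> values on the
  chain, estimated crudely by arbitrary functions, and by \<open>k\<close> members of
  \<open>tie_homs P E S\<close>.\<close>

lemma card_tie_homs_le_power:
  assumes max: "\<And>d. \<not> strict_chain Q (Suc h) d"
    and disj: "Field Q \<inter> Field S = {}" and E: "E \<subseteq> P"
    and fin: "finite (Field P)" "finite (Field Q)" "finite (Field S)"
  shows "card (tie_homs (chain_copies h k P) (copies_ties h k E) (Q \<oplus> S))
    \<le> card (Field (Q \<oplus> S)) ^ h * card (tie_homs P E S) ^ k"
proof -
  let ?A = "{..<h} \<rightarrow>\<^sub>E Field (Q \<oplus> S)" and ?B = "{..<k} \<rightarrow>\<^sub>E tie_homs P E S"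
  let ?X = "chain_copies h k P" and ?E = "copies_ties h k E"
  define \<Phi> where "\<Phi> \<eta> = (\<lambda>i\<in>{..<h}. \<eta> (Inl i), \<lambda>j\<in>{..<k}. \<lambda>p\<in>Field P. \<eta> (Inr (j, p)))"
    for \<eta> :: "nat + nat \<times> 'b \<Rightarrow> 'a"
  have "card (tie_homs ?X ?E (Q \<oplus> S)) \<le> card (?A \<times> ?B)"
  proof (rule card_inj_on_le)
    show "inj_on \<Phi> (tie_homs ?X ?E (Q \<oplus> S))"
    proof (rule inj_onI)
      fix \<xi> \<zeta>
      assume *: "\<xi> \<in> tie_homs ?X ?E (Q \<oplus> S)" "\<zeta> \<in> tie_homs ?X ?E (Q \<oplus> S)" "\<Phi> \<xi> = \<Phi> \<zeta>"
      have "\<xi> (Inl i) = \<zeta> (Inl i)" if "i < h" for i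
        using *(3) that unfolding \<Phi>_def by (metis (mono_tags) Pair_inject lessThan_iff restrict_apply')
      moreover have "\<xi> (Inr (j, p)) = \<zeta> (Inr (j, p))" if "j < k" "p \<in> Field P" for j p
        using *(3) that unfolding \<Phi>_def by (metis (mono_tags, lifting) Pair_inject lessThan_iff restrict_apply')
      ultimately have "\<xi> x = \<zeta> x" if "x \<in> Field ?X" for x
        using that by (auto simp: Field_chain_copies)
      then show "\<xi> = \<zeta>" using * Hom_ext[of \<xi> ?X "Q \<oplus> S" \<zeta>] by (auto simp: tie_homs_def)
    qed
    show "\<Phi> ` tie_homs ?X ?E (Q \<oplus> S) \<subseteq> ?A \<times> ?B"
    proof
      fix \<theta> assume "\<theta> \<in> \<Phi> ` tie_homs ?X ?E (Q \<oplus> S)"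
      then obtain \<eta> where \<eta>: "\<theta> = \<Phi> \<eta>" "\<eta> \<in> Hom ?X (Q \<oplus> S)" "ties ?X \<eta> = ?E"
        by (auto simp: tie_homs_def)
      have tie: "\<eta> x = \<eta> y \<longleftrightarrow> (x, y) \<in> ?E" if "(x, y) \<in> ?X" for x y
        using that unfolding \<eta>(3)[symmetric] ties_def by simp
      have chain: "\<eta> (Inl i) \<in> Field (Q \<oplus> S)" if "i < h" for i
        using Hom_Field[OF \<eta>(2)] that by (auto simp: Field_chain_copies)
      have in_S: "\<eta> (Inr (j, p)) \<in> Field S" if jp: "j < k" "p \<in> Field P" for j p
      proof (rule ccontr)
        assume "\<eta> (Inr (j, p)) \<notin> Field S"
        moreover have "\<eta> (Inr (j, p)) \<in> Field (Q \<oplus> S)"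
          using Hom_Field[OF \<eta>(2)] jp by (auto simp: Field_chain_copies)
        ultimately have top: "\<eta> (Inr (j, p)) \<in> Field Q" by (simp add: Field_ord_sum)
        have below: "(\<eta> (Inl i), \<eta> (Inr (j, p))) \<in> Q \<and> \<eta> (Inl i) \<noteq> \<eta> (Inr (j, p))" if "i < h" for i
          using tie[of "Inl i" "Inr (j, p)"] that jp
          by (auto intro!: ord_sum_left[OF disj _ top] Hom_mono[OF \<eta>(2)])
        have chainQ: "(\<eta> (Inl i), \<eta> (Inl i')) \<in> Q \<and> \<eta> (Inl i) \<noteq> \<eta> (Inl i')"
          if "i < i'" "i' < h" for i i'
        proof -
          \<comment> \<open>The chain values lie below an element of \<open>Q\<close>, and
            \<open>Q\<close> is a down-set of the ordinal sum.\<close>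
          have "\<eta> (Inl i') \<in> Field Q" using below[OF that(2)] by (auto intro: FieldI1)
          then show ?thesis using tie[of "Inl i" "Inl i'"] that
            by (auto intro!: ord_sum_left[OF disj] Hom_mono[OF \<eta>(2)])
        qed
        \<comment> \<open>The offending copy value is put on top of the \<open>h\<close> chain
          values, at index \<open>h\<close>, giving a strict chain in \<open>Q\<close> that is too
          long.\<close>
        define d where "d i = (if i < h then \<eta> (Inl i) else \<eta> (Inr (j, p)))" for i
        have "strict_chain Q (Suc h) d"
          using below chainQ top
          by (auto simp: strict_chain_def d_def less_Suc_eq intro: FieldI1)
        then show False using max by blast
      qed
      have "restrict (\<lambda>p. \<eta> (Inr (j, p))) (Field P) \<in> tie_homs P E S" (is "?\<zeta> \<in> _") if j: "j < k" for j
      proof -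
        have F: "p \<in> Field P \<and> q \<in> Field P" if "(p, q) \<in> P" for p q
          using that by (blast intro: FieldI1 FieldI2)
        have "?\<zeta> \<in> Hom P S"
        proof (rule HomI)
          fix p q assume pq: "(p, q) \<in> P"
          then have "(\<eta> (Inr (j, p)), \<eta> (Inr (j, q))) \<in> S"
            using j F[OF pq] by (intro ord_sum_right[OF disj] Hom_mono[OF \<eta>(2)] in_S) auto
          then show "(?\<zeta> p, ?\<zeta> q) \<in> S" using F[OF pq] by simp
        qed (use in_S j in auto)
        moreover have "?\<zeta> p = ?\<zeta> q \<longleftrightarrow> (p, q) \<in> E" if "(p, q) \<in> P" for p q
          using tie[of "Inr (j, p)" "Inr (j, q)"] that F[OF that] j by simp
        then have "ties P ?\<zeta> = E" using E unfolding ties_def by blast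
        ultimately show ?thesis by (simp add: tie_homs_def)
      qed
      then show "\<theta> \<in> ?A \<times> ?B" using chain unfolding \<eta>(1) \<Phi>_def by auto
    qed
    show "finite (?A \<times> ?B)"
      using fin by (intro finite_cartesian_product finite_PiE finite_tie_homs) (auto simp: Field_ord_sum)
  qed
  then show ?thesis by (simp add: card_funcsetE card_cartesian_product)
qed

section \<open>Comparison of exponential growth, and the conclusion\<close>

lemma le_if_power_le_const_mult_power:
  fixes a b c :: nat
  assumes "\<And>k. k > 0 \<Longrightarrow> a ^ k \<le> c * b ^ k"
  shows "a \<le> b"
proof (rule ccontr)
  assume "\<not> a \<le> b"
  \<comment> \<open>For \<open>b > 0\<close> this is Bernoulli's inequality
    \<open>(1 + 1/b)^k >= 1 + k/b\<close>, multiplied by \<open>b^(k+1)\<close> to stay within the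
    natural numbers. It shows that the quotient of \<open>a ^ k\<close> and \<open>b ^ k\<close>
    would be unbounded.\<close>
  have bern: "b ^ k * (b + k) \<le> b * (b + 1) ^ k" for k
  proof (induction k)
    case (Suc k)
    have "b ^ Suc k * (b + Suc k) \<le> (b + 1) * (b ^ k * (b + k))"
      by (simp add: algebra_simps)
    also have "\<dots> \<le> (b + 1) * (b * (b + 1) ^ k)" using Suc by (rule mult_le_mono2)
    finally show ?case by (simp add: mult_ac)
  qed simp
  \<comment> \<open>Large enough that \<open>b + k \<le> b * c\<close> fails; after cancelling
    \<open>b ^ k\<close> only \<open>b = 0\<close> survives, which exponent 1 refutes.\<close>
  define k where "k = b * c + 1"
  have "b ^ k * (b + k) \<le> b * (b + 1) ^ k" by (rule bern)
  also have "\<dots> \<le> b * a ^ k" using \<open>\<not> a \<le> b\<close> by (intro mult_le_mono2 power_mono) auto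
  also have "\<dots> \<le> b * (c * b ^ k)" using assms[of k] by (intro mult_le_mono2) (simp add: k_def)
  also have "\<dots> = b ^ k * (b * c)" by simp
  finally have "b ^ k * (b + k) \<le> b ^ k * (b * c)" .
  then have "b = 0 \<or> b + k \<le> b * c" by auto
  then have "b = 0" by (simp add: k_def)
  then show False using assms[of 1] \<open>\<not> a \<le> b\<close> by simp
qed

theorem theorem5:
  fixes \<PP> :: "'p rel set" and Q R S :: "'a rel"
  assumes "rep_system \<PP>"
    and "fin_poset Q" and "fin_poset R" and "fin_poset S"
    and "Field Q \<inter> Field R = {}" and "Field Q \<inter> Field S = {}"
    and "G_le \<PP> (Q \<oplus> R) (Q \<oplus> S)"
  shows "G_le \<PP> R S"
proof -
  have fin: "finite (Field Q)" "finite (Field R)" "finite (Field S)" and refl: "refl_on (Field Q) Q"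
    using assms(2-4) by (auto simp: fin_poset_def order_on_defs)
  have PP: "fin_poset P" "finite (Field P)" if "P \<in> \<PP>" for P
    using assms(1) that by (auto simp: rep_system_def fin_poset_def)
  \<comment> \<open>\<open>h\<close> depends on \<open>Q\<close> alone, so the factor contributed by
    the chain is the same for all \<open>k\<close>.\<close>
  obtain h c where h: "strict_chain Q h c" "\<And>d. \<not> strict_chain Q (Suc h) d"
    using longest_strict_chain[OF fin(1)] by blast
  have "card (tie_homs P E R) \<le> card (tie_homs P E S)" if P: "P \<in> \<PP>" for P E
  proof (cases "E \<subseteq> P")
    case True
    show ?thesis
    proof (rule le_if_power_le_const_mult_power)
      fix k :: nat assume "k > 0"
      let ?X = "chain_copies h k P" and ?E = "copies_ties h k E"
      have "card (tie_homs P E R) ^ k \<le> card (tie_homs ?X ?E (Q \<oplus> R))"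
        using h(1) refl assms(5) PP(2)[OF P] fin(1,2) by (rule card_tie_homs_power_le)
      \<comment> \<open>Here the assumed relation between the two ordinal sums enters, applied to
        the test poset.\<close>
      also have "\<dots> \<le> card (tie_homs ?X ?E (Q \<oplus> S))"
        using assms(1,7) fin_poset_chain_copies[OF PP(1)[OF P] \<open>k > 0\<close>]
        by (rule G_le_card_tie_homs_le) (simp_all add: Field_ord_sum fin)
      also have "\<dots> \<le> card (Field (Q \<oplus> S)) ^ h * card (tie_homs P E S) ^ k"
        using h(2) assms(6) True PP(2)[OF P] fin(1,3) by (rule card_tie_homs_le_power)
      finally show "card (tie_homs P E R) ^ k
        \<le> card (Field (Q \<oplus> S)) ^ h * card (tie_homs P E S) ^ k" .
    qed
  next
    case False
    then have "tie_homs P E R = {}" using ties_subset by (fastforce simp: tie_homs_def)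
    then show ?thesis by simp
  qed
  then show ?thesis using G_le_iff_card_tie_homs[of \<PP> R S] PP(2) fin by blast
qed

end
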